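(* Let $N\ge 2$ and let $\mathcal{H}=\mathcal{H}^{(1)}\otimes\cdots\otimes\mathcal{H}^{(N)}$ with each $\mathcal{H}^{(j)}$ a complex Hilbert space of finite dimension $D^{(j)}\ge 2$. Let $E_g$ be the normalized General Entanglement (see context), where observables are normalized with respect to the trace scalar product $(A,B)=\operatorname{Tr}(AB)$, i.e. $\|A\|^2=\operatorname{Tr}A^2$. Then $E_g$ is monotone (non-increasing) under LOCC: if $|\psi\rangle,|\phi\rangle\in\mathcal{H}$ are unit vectors such that $|\psi\rangle$ can be transformed into $|\phi\rangle$ by LOCC among the $N$ subsystems, then $$E_g(|\phi\rangle\langle\phi|)\le E_g(|\psi\rangle\langle\psi|).$$
   Context: For $j\in\{1,\dots,N\}$, let $\mathcal{H}^{(r)}=\bigotimes_{k\ne j}\mathcal{H}^{(k)}$ denote the rest of the system, so that $\mathcal{H}\cong\mathcal{H}^{(j)}\otimes\mathcal{H}^{(r)}$. A projective measurement $\mathcal{M}^j$ on the rest of the system is a family $\{\mathcal{P}_i\}$ with $\mathcal{P}_i=\mathbb{I}^{(j)}\otimes\mathcal{P}_i^{(r)}$, where $\mathcal{P}_i^{(r)}=|\chi_i\rangle\langle\chi_i|$ and $\{|\chi_i\rangle\}$ is an orthonormal basis of $\mathcal{H}^{(r)}$. For a pure state $\rho=|\psi\rangle\langle\psi|$, outcome $i$ occurs with probability $p_i=\operatorname{Tr}(\rho\mathcal{P}_i)$, and if $p_i\neq 0$ the post-measurement state is $\rho_i=\frac{1}{p_i}\mathcal{P}_i\rho\mathcal{P}_i$.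 Outcomes with $p_i=0$ contribute $0$ to the sum below. Let $\Omega^{(j)}$ be the set of operators $\mathcal{O}=\mathcal{O}^{(j)}\otimes\mathbb{I}^{(r)}$ with $\mathcal{O}^{(j)}$ a Hermitian operator on $\mathcal{H}^{(j)}$, $\operatorname{Tr}\mathcal{O}^{(j)}=0$ and $\operatorname{Tr}\bigl((\mathcal{O}^{(j)})^2\bigr)=1$. Define $$R_{\mathcal{O}}^{(j),\mathcal{P}_i}(\rho)=\bigl(\operatorname{Tr}(\rho\mathcal{O})-\operatorname{Tr}(\rho_i\mathcal{O})\bigr)^2,\qquad \mathcal{E}^{(j)}_{\mathcal{M}^j}(\rho)=\sum_i p_i\max_{\mathcal{O}\in\Omega^{(j)}}R_{\mathcal{O}}^{(j),\mathcal{P}_i}(\rho).$$ The normalized General Entanglement is $$E_g(\rho)=\frac1N\sum_{j=1}^N\Bigl(1-\frac{1}{D^{(j)}}\Bigr)^{-1}\max_{\mathcal{M}^j}\mathcal{E}^{(j)}_{\mathcal{M}^j}(\rho),$$ the maximum being over all projective measurements $\mathcal{M}^j$ on the rest of the system. LOCC (local operations and classical communication): a protocol with finitely many rounds; in each round one party $k$ (chosen depending on all previous outcomes) performs on its own space $\mathcal{H}^{(k)}$ a generalized measurement with finitely many Kraus operators $\{M_a\}$, $\sum_a M_a^\dagger M_a=\mathbb{I}^{(k)}$ (the choice of which may depend on all previous outcomes), and broadcasts the outcome $a$ to all parties; outcome $a$ maps the current unit vector $|\xi\rangle$ to the normalization of $(M_a\otimes\mathbb{I})|\xi\rangle$, with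 probability $\|(M_a\otimes\mathbb{I})\xi\|^2$. The vector $|\psi\rangle$ can be transformed into $|\phi\rangle$ by LOCC if there is such a protocol which, started from $|\psi\rangle$, ends in $|\phi\rangle$ (up to a global phase) along every sequence of outcomes of nonzero probability. *)

theory Defs
  imports Complex_Main "HOL-Library.FuncSet" "HOL-Analysis.L2_Norm"
begin

text \<open>
  The Hilbert space with orthonormal basis indexed by a finite set \<open>I\<close> consists of the
  functions into the complex numbers that vanish outside \<open>I\<close>. An operator on it is
  given by its matrix entries with respect to that basis; only the entries at positions in
  \<open>I \<times> I\<close> carry meaning, the values of the function elsewhere are never used.
\<close>

type_synonym 'i cvec = "'i \<Rightarrow> complex"
type_synonym 'i cop = "'i \<Rightarrow> 'i \<Rightarrow> complex"

definition hilb :: "'i set \<Rightarrow> 'i cvec set" where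
  "hilb I = {v. \<forall>x. x \<notin> I \<longrightarrow> v x = 0}"

definition vec_norm :: "'i set \<Rightarrow> 'i cvec \<Rightarrow> real" where
  "vec_norm I v = L2_set (\<lambda>x. cmod (v x)) I"

definition vec_inner :: "'i set \<Rightarrow> 'i cvec \<Rightarrow> 'i cvec \<Rightarrow> complex" where
  "vec_inner I u v = (\<Sum>x\<in>I. cnj (u x) * v x)"

definition orthonormal_basis :: "'i set \<Rightarrow> 'i cvec set \<Rightarrow> bool" where
  "orthonormal_basis I B \<longleftrightarrow>
     finite B \<and> B \<subseteq> hilb I \<and>
     (\<forall>u\<in>B. \<forall>v\<in>B. vec_inner I u v = (if u = v then 1 else 0)) \<and>
     (\<forall>v\<in>hilb I. \<exists>c. v = (\<lambda>x. \<Sum>u\<in>B. c u * u x))"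

definition op_id :: "'i cop" where
  "op_id = (\<lambda>x y. if x = y then 1 else 0)"

definition op_mult :: "'i set \<Rightarrow> 'i cop \<Rightarrow> 'i cop \<Rightarrow> 'i cop" where
  "op_mult I A B = (\<lambda>x y. \<Sum>z\<in>I. A x z * B z y)"

definition op_adj :: "'i cop \<Rightarrow> 'i cop" where
  "op_adj A = (\<lambda>x y. cnj (A y x))"

definition op_trace :: "'i set \<Rightarrow> 'i cop \<Rightarrow> complex" where
  "op_trace I A = (\<Sum>x\<in>I. A x x)"

definition op_apply :: "'i set \<Rightarrow> 'i cop \<Rightarrow> 'i cvec \<Rightarrow> 'i cvec" where
  "op_apply I A v = (\<lambda>x. if x \<in> I then \<Sum>y\<in>I. A x y * v y else 0)"

definition hermitian :: "'i set \<Rightarrow> 'i cop \<Rightarrow> bool" where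
  "hermitian I A \<longleftrightarrow> (\<forall>x\<in>I. \<forall>y\<in>I. op_adj A x y = A x y)"

definition ketbra :: "'i cvec \<Rightarrow> 'i cvec \<Rightarrow> 'i cop" where
  "ketbra u v = (\<lambda>x y. u x * cnj (v y))"

text \<open>
  The parties are \<open>1, \<dots>, N\<close>, and party \<open>k\<close> has the space with basis \<open>{..<D k}\<close>. The
  product basis of a set \<open>J\<close> of parties is indexed by the functions assigning to each
  \<open>k \<in> J\<close> a basis index of party \<open>k\<close>. The identification of the whole space with
  (space of \<open>j\<close>) \<open>\<otimes>\<close> (rest) sends the basis index \<open>x\<close> to the pair consisting of \<open>x j\<close> and
  of the restriction of \<open>x\<close> to the remaining parties.
\<close>

definition configs :: "(nat \<Rightarrow> nat) \<Rightarrow> nat set \<Rightarrow> (nat \<Rightarrow> nat) set" where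
  "configs D J = (\<Pi>\<^sub>E k\<in>J. {..<D k})"

abbreviation whole :: "nat \<Rightarrow> (nat \<Rightarrow> nat) \<Rightarrow> (nat \<Rightarrow> nat) set" where
  "whole N D \<equiv> configs D {1..N}"

abbreviation rest :: "nat \<Rightarrow> (nat \<Rightarrow> nat) \<Rightarrow> nat \<Rightarrow> (nat \<Rightarrow> nat) set" where
  "rest N D j \<equiv> configs D ({1..N} - {j})"

definition tensor_op :: "nat \<Rightarrow> nat \<Rightarrow> nat cop \<Rightarrow> (nat \<Rightarrow> nat) cop \<Rightarrow> (nat \<Rightarrow> nat) cop" where
  "tensor_op N j A B =
     (\<lambda>x y. A (x j) (y j) * B (restrict x ({1..N} - {j})) (restrict y ({1..N} - {j})))"

definition projective_measurements ::
    "nat \<Rightarrow> (nat \<Rightarrow> nat) \<Rightarrow> nat \<Rightarrow> (nat \<Rightarrow> nat) cop set set" where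
  "projective_measurements N D j =
     {(\<lambda>\<chi>. tensor_op N j op_id (ketbra \<chi> \<chi>)) ` B | B. orthonormal_basis (rest N D j) B}"

definition observables :: "nat \<Rightarrow> (nat \<Rightarrow> nat) \<Rightarrow> nat \<Rightarrow> (nat \<Rightarrow> nat) cop set" where
  "observables N D j =
     {tensor_op N j A op_id | A.
        hermitian {..<D j} A \<and> op_trace {..<D j} A = 0 \<and>
        op_trace {..<D j} (op_mult {..<D j} A A) = 1}"

text \<open>
  The traces below are real for Hermitian arguments; \<open>Re\<close> only converts the type.
\<close>

definition expval :: "nat \<Rightarrow> (nat \<Rightarrow> nat) \<Rightarrow> (nat \<Rightarrow> nat) cop \<Rightarrow> (nat \<Rightarrow> nat) cop \<Rightarrow> real" where
  "expval N D \<rho> A = Re (op_trace (whole N D) (op_mult (whole N D) \<rho> A))"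

definition post_meas ::
    "nat \<Rightarrow> (nat \<Rightarrow> nat) \<Rightarrow> (nat \<Rightarrow> nat) cop \<Rightarrow> (nat \<Rightarrow> nat) cop \<Rightarrow> (nat \<Rightarrow> nat) cop" where
  "post_meas N D \<rho> P =
     (\<lambda>x y. complex_of_real (1 / expval N D \<rho> P) *
              op_mult (whole N D) (op_mult (whole N D) P \<rho>) P x y)"

definition disturbance ::
    "nat \<Rightarrow> (nat \<Rightarrow> nat) \<Rightarrow> (nat \<Rightarrow> nat) cop \<Rightarrow> (nat \<Rightarrow> nat) cop \<Rightarrow> (nat \<Rightarrow> nat) cop \<Rightarrow> real" where
  "disturbance N D \<rho> P A = (expval N D \<rho> A - expval N D (post_meas N D \<rho> P) A)\<^sup>2"

text \<open>
  \<open>GREATEST\<close> denotes the maximum; both maxima below are attained because the observables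
  and the orthonormal bases form compact sets. Outcomes of probability zero contribute zero.
\<close>

definition measured_entanglement ::
    "nat \<Rightarrow> (nat \<Rightarrow> nat) \<Rightarrow> nat \<Rightarrow> (nat \<Rightarrow> nat) cop set \<Rightarrow> (nat \<Rightarrow> nat) cop \<Rightarrow> real" where
  "measured_entanglement N D j M \<rho> =
     (\<Sum>P\<in>M. if expval N D \<rho> P = 0 then 0
            else expval N D \<rho> P *
                 (GREATEST r. r \<in> disturbance N D \<rho> P ` observables N D j))"

definition general_entanglement :: "nat \<Rightarrow> (nat \<Rightarrow> nat) \<Rightarrow> (nat \<Rightarrow> nat) cop \<Rightarrow> real" where
  "general_entanglement N D \<rho> =
     1 / real N *
     (\<Sum>j=1..N. inverse (1 - 1 / real (D j)) *
        (GREATEST e. e \<in> (\<lambda>M. measured_entanglement N D j M \<rho>) ` projective_measurements N D j))"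

text \<open>
  A protocol of \<open>n\<close> rounds: the history \<open>h\<close> is the list of previous outcomes, most recent
  first; \<open>party h\<close> acts next, with the Kraus operators listed in \<open>kraus h\<close>, and outcome
  \<open>a\<close> is the position of the Kraus operator in that list.
\<close>

definition locc_protocol ::
    "nat \<Rightarrow> (nat \<Rightarrow> nat) \<Rightarrow> nat \<Rightarrow> (nat list \<Rightarrow> nat) \<Rightarrow> (nat list \<Rightarrow> nat cop list) \<Rightarrow> bool" where
  "locc_protocol N D n party kraus \<longleftrightarrow>
     (\<forall>h. length h < n \<longrightarrow>
        party h \<in> {1..N} \<and>
        (\<forall>x<D (party h). \<forall>y<D (party h).
           (\<Sum>a<length (kraus h). op_mult {..<D (party h)} (op_adj (kraus h ! a)) (kraus h ! a) x y)
             = op_id x y))"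

definition local_apply ::
    "nat \<Rightarrow> (nat \<Rightarrow> nat) \<Rightarrow> nat \<Rightarrow> nat cop \<Rightarrow> (nat \<Rightarrow> nat) cvec \<Rightarrow> (nat \<Rightarrow> nat) cvec" where
  "local_apply N D k M v = op_apply (whole N D) (tensor_op N k M op_id) v"

definition normalized :: "'i set \<Rightarrow> 'i cvec \<Rightarrow> 'i cvec" where
  "normalized I v = (\<lambda>x. v x / complex_of_real (vec_norm I v))"

primrec locc_state ::
    "nat \<Rightarrow> (nat \<Rightarrow> nat) \<Rightarrow> (nat list \<Rightarrow> nat) \<Rightarrow> (nat list \<Rightarrow> nat cop list) \<Rightarrow>
     (nat \<Rightarrow> nat) cvec \<Rightarrow> nat list \<Rightarrow> (nat \<Rightarrow> nat) cvec" where
  "locc_state N D party kraus \<psi> [] = \<psi>"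
| "locc_state N D party kraus \<psi> (a # h) =
     normalized (whole N D)
       (local_apply N D (party h) (kraus h ! a) (locc_state N D party kraus \<psi> h))"

text \<open>
  The probability of a sequence of outcomes is the product of the probabilities of its
  outcomes, conditional on the preceding ones.
\<close>

primrec locc_prob ::
    "nat \<Rightarrow> (nat \<Rightarrow> nat) \<Rightarrow> (nat list \<Rightarrow> nat) \<Rightarrow> (nat list \<Rightarrow> nat cop list) \<Rightarrow>
     (nat \<Rightarrow> nat) cvec \<Rightarrow> nat list \<Rightarrow> real" where
  "locc_prob N D party kraus \<psi> [] = 1"
| "locc_prob N D party kraus \<psi> (a # h) =
     (if a < length (kraus h)
      then (vec_norm (whole N D)
              (local_apply N D (party h) (kraus h ! a) (locc_state N D party kraus \<psi> h)))\<^sup>2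
      else 0) * locc_prob N D party kraus \<psi> h"

definition locc_transformable ::
    "nat \<Rightarrow> (nat \<Rightarrow> nat) \<Rightarrow> (nat \<Rightarrow> nat) cvec \<Rightarrow> (nat \<Rightarrow> nat) cvec \<Rightarrow> bool" where
  "locc_transformable N D \<psi> \<phi> \<longleftrightarrow>
     (\<exists>n party kraus. locc_protocol N D n party kraus \<and>
        (\<forall>h. length h = n \<and> locc_prob N D party kraus \<psi> h \<noteq> 0 \<longrightarrow>
           (\<exists>c. cmod c = 1 \<and> locc_state N D party kraus \<psi> h = (\<lambda>x. c * \<phi> x))))"

end

theory Submission
  imports Defs "HOL-Analysis.Convex"
begin

text \<open>
  Let \<open>\<rho>\<close> be the reduced state of party \<open>j\<close>. After outcome \<open>\<chi>\<close>, of probability \<open>p\<close>, party \<open>j\<close> is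
  in a pure state \<open>\<sigma>\<close>, and by Cauchy--Schwarz the maximal disturbance is the squared
  Hilbert--Schmidt norm of the traceless operator \<open>\<rho> - \<sigma>\<close>, that is
  \<open>Tr \<rho>\<^sup>2 - 2 Tr (\<rho> \<sigma>) + 1\<close>. Since the states \<open>\<sigma>\<close> average to \<open>\<rho>\<close>, every measurement gives the
  same value \<open>1 - Tr \<rho>\<^sup>2\<close>. It remains to see that the purity does not decrease on average under a
  local measurement. Such a measurement preserves on average the reduced states of all parties
  that do not measure, and the purity is convex; for the measuring party itself one uses that
  the purity of \<open>\<rho>\<close> is also the purity of the complementary reduced state.
\<close>

text \<open>Keeps the bound of \<open>{1..N}\<close> in the form \<open>1\<close> under
  simplification.\<close>

declare One_nat_def [simp del]

section \<open>Bipartite amplitudes: reduced states, purity and Kraus operators\<close>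

text \<open>If \<open>\<Psi> a r\<close> are the amplitudes of a vector in a tensor product, this is
  its reduced density matrix with the second factor traced out. Curried amplitudes allow the two
  factors to be exchanged by swapping arguments.\<close>

definition gram :: "'b set \<Rightarrow> ('a \<Rightarrow> 'b \<Rightarrow> complex) \<Rightarrow> 'a \<Rightarrow> 'a \<Rightarrow> complex" where
  "gram B \<Psi> a b = (\<Sum>r\<in>B. \<Psi> a r * cnj (\<Psi> b r))"

definition hs_norm2 :: "'a set \<Rightarrow> ('a \<Rightarrow> 'a \<Rightarrow> complex) \<Rightarrow> real" where
  "hs_norm2 A T = (\<Sum>a\<in>A. \<Sum>b\<in>A. (cmod (T a b))\<^sup>2)"

definition purity :: "'a set \<Rightarrow> 'b set \<Rightarrow> ('a \<Rightarrow> 'b \<Rightarrow> complex) \<Rightarrow> real" where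
  "purity A B \<Psi> = hs_norm2 A (gram B \<Psi>)"

text \<open>Vectors stay unnormalized, and the weight is the trace of the reduced matrix. The purity
  of the normalized vector is \<open>purity\<close> divided by the squared weight.\<close>

definition weight :: "'a set \<Rightarrow> 'b set \<Rightarrow> ('a \<Rightarrow> 'b \<Rightarrow> complex) \<Rightarrow> real" where
  "weight A B \<Psi> = (\<Sum>a\<in>A. \<Sum>r\<in>B. (cmod (\<Psi> a r))\<^sup>2)"

lemma of_real_hs_norm2:
  "complex_of_real (hs_norm2 A T) = (\<Sum>a\<in>A. \<Sum>b\<in>A. T a b * cnj (T a b))"
  by (simp only: hs_norm2_def of_real_sum complex_norm_square)

lemma hs_norm2_nonneg: "0 \<le> hs_norm2 A T"
  unfolding hs_norm2_def by (intro sum_nonneg) auto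

lemma weight_nonneg: "0 \<le> weight A B \<Psi>"
  unfolding weight_def by (intro sum_nonneg) auto

lemma weight_flip: "weight A B \<Psi> = weight B A (\<lambda>r a. \<Psi> a r)"
  unfolding weight_def by (rule sum.swap)

lemma of_real_weight: "complex_of_real (weight A B \<Psi>) = (\<Sum>a\<in>A. gram B \<Psi> a a)"
  by (simp only: weight_def gram_def of_real_sum complex_norm_square)

text \<open>The two reduced states of a pure state share their nonzero spectrum. No spectral theory
  is used: both purities expand to one fourfold sum, and only the order of summation
  differs.\<close>

lemma purity_flip: "purity A B \<Psi> = purity B A (\<lambda>r a. \<Psi> a r)"
proof -
  have 1: "complex_of_real (purity A B \<Psi>) =
      (\<Sum>a\<in>A. \<Sum>b\<in>A. \<Sum>r\<in>B. \<Sum>s\<in>B. \<Psi> a r * cnj (\<Psi> b r) * (cnj (\<Psi> a s) * \<Psi> b s))"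
    unfolding purity_def of_real_hs_norm2 gram_def by (simp add: sum_product)
  also have "\<dots> = (\<Sum>a\<in>A. \<Sum>r\<in>B. \<Sum>b\<in>A. \<Sum>s\<in>B. \<Psi> a r * cnj (\<Psi> b r) * (cnj (\<Psi> a s) * \<Psi> b s))"
    by (intro sum.cong refl sum.swap)
  also have "\<dots> = (\<Sum>r\<in>B. \<Sum>a\<in>A. \<Sum>s\<in>B. \<Sum>b\<in>A. \<Psi> a r * cnj (\<Psi> b r) * (cnj (\<Psi> a s) * \<Psi> b s))"
    by (subst sum.swap) (intro sum.cong refl sum.swap)
  also have "\<dots> = (\<Sum>r\<in>B. \<Sum>s\<in>B. \<Sum>a\<in>A. \<Sum>b\<in>A. \<Psi> a r * cnj (\<Psi> b r) * (cnj (\<Psi> a s) * \<Psi> b s))"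
    by (intro sum.cong refl sum.swap)
  also have "\<dots> = complex_of_real (purity B A (\<lambda>r a. \<Psi> a r))"
    unfolding purity_def of_real_hs_norm2 gram_def
    by (simp add: sum_product mult_ac)
  finally show ?thesis by (simp only: of_real_eq_iff)
qed

text \<open>Cauchy--Schwarz in Engel form. As division by zero yields zero, terms with
  \<open>p i = 0\<close> are lost on the right; the second assumption makes them vanish on the left
  too.\<close>

lemma cmod_sum_squared_le:
  assumes "\<And>i. i \<in> I \<Longrightarrow> 0 \<le> p i" and "\<And>i. i \<in> I \<Longrightarrow> p i = 0 \<Longrightarrow> z i = 0"
  shows "(cmod (\<Sum>i\<in>I. z i))\<^sup>2 \<le> (\<Sum>i\<in>I. p i) * (\<Sum>i\<in>I. (cmod (z i))\<^sup>2 / p i)"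
proof -
  have "cmod (\<Sum>i\<in>I. z i) \<le> (\<Sum>i\<in>I. cmod (z i))"
    by (rule norm_sum)
  also have "\<dots> = (\<Sum>i\<in>I. sqrt (p i) * (cmod (z i) / sqrt (p i)))"
    using assms by (intro sum.cong) auto
  finally have "(cmod (\<Sum>i\<in>I. z i))\<^sup>2 \<le> (\<Sum>i\<in>I. sqrt (p i) * (cmod (z i) / sqrt (p i)))\<^sup>2"
    by (intro power_mono) auto
  also have "\<dots> \<le> (\<Sum>i\<in>I. (sqrt (p i))\<^sup>2) * (\<Sum>i\<in>I. (cmod (z i) / sqrt (p i))\<^sup>2)"
    by (rule Cauchy_Schwarz_ineq_sum)
  also have "\<dots> = (\<Sum>i\<in>I. p i) * (\<Sum>i\<in>I. (cmod (z i))\<^sup>2 / p i)"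
    using assms(1) by (simp add: power_divide cong: sum.cong)
  finally show ?thesis .
qed

text \<open>Zero weight forces all amplitudes to vanish; this supplies the side condition of
  \<open>cmod_sum_squared_le\<close>.\<close>

lemma gram_eq_0:
  assumes "finite A" "finite B" "weight A B \<Psi> = 0" "a \<in> A"
  shows "gram B \<Psi> a b = 0"
proof -
  have "(\<Sum>r\<in>B. (cmod (\<Psi> a r))\<^sup>2) = 0"
    using assms sum_nonneg_eq_0_iff[of A "\<lambda>a. \<Sum>r\<in>B. (cmod (\<Psi> a r))\<^sup>2"]
    by (simp add: weight_def sum_nonneg)
  then have "\<And>r. r \<in> B \<Longrightarrow> \<Psi> a r = 0"
    using assms(2) by (simp add: sum_nonneg_eq_0_iff)
  then show ?thesis by (simp add: gram_def)
qed

text \<open>Each quotient is the weight of \<open>\<Phi> i\<close> times its normalized purity, so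
  this is convexity of the purity. It follows from the Engel form of Cauchy--Schwarz applied to
  every matrix entry.\<close>

lemma purity_convex:
  assumes "finite A" "finite B"
    and g: "\<And>a b. a \<in> A \<Longrightarrow> b \<in> A \<Longrightarrow> gram B \<Psi> a b = (\<Sum>i\<in>I. gram B (\<Phi> i) a b)"
  shows "purity A B \<Psi> \<le> weight A B \<Psi> * (\<Sum>i\<in>I. purity A B (\<Phi> i) / weight A B (\<Phi> i))"
proof -
  \<comment> \<open>Taking the trace of the hypothesis shows that the weights add up.\<close>
  have "complex_of_real (weight A B \<Psi>) = complex_of_real (\<Sum>i\<in>I. weight A B (\<Phi> i))"
    unfolding of_real_sum of_real_weight
    by (subst sum.swap) (simp add: g)
  then have w: "weight A B \<Psi> = (\<Sum>i\<in>I. weight A B (\<Phi> i))"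
    by (simp only: of_real_eq_iff)
  have "purity A B \<Psi> \<le> (\<Sum>a\<in>A. \<Sum>b\<in>A. weight A B \<Psi> *
          (\<Sum>i\<in>I. (cmod (gram B (\<Phi> i) a b))\<^sup>2 / weight A B (\<Phi> i)))"
    unfolding purity_def hs_norm2_def w using assms
    by (intro sum_mono) (auto intro!: cmod_sum_squared_le weight_nonneg gram_eq_0)
  also have "\<dots> = weight A B \<Psi> *
          (\<Sum>a\<in>A. \<Sum>b\<in>A. \<Sum>i\<in>I. (cmod (gram B (\<Phi> i) a b))\<^sup>2 / weight A B (\<Phi> i))"
    by (simp add: sum_distrib_left)
  also have "(\<Sum>a\<in>A. \<Sum>b\<in>A. \<Sum>i\<in>I. (cmod (gram B (\<Phi> i) a b))\<^sup>2 / weight A B (\<Phi> i)) =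
        (\<Sum>a\<in>A. \<Sum>i\<in>I. \<Sum>b\<in>A. (cmod (gram B (\<Phi> i) a b))\<^sup>2 / weight A B (\<Phi> i))"
    by (intro sum.cong refl sum.swap)
  also have "\<dots> = (\<Sum>i\<in>I. purity A B (\<Phi> i) / weight A B (\<Phi> i))"
    unfolding purity_def hs_norm2_def
    by (subst sum.swap) (simp add: sum_divide_distrib)
  finally show ?thesis .
qed

text \<open>By the completeness relation the operators \<open>M i\<close>, stacked on top of each
  other, form an isometry. The sums over \<open>b\<close> and \<open>c\<close> are moved outwards
  until that relation is the inner sum.\<close>

lemma kraus_preserves_inner:
  fixes M :: "'i \<Rightarrow> 'a cop"
  assumes "finite X"
    and M: "\<And>b c. b \<in> X \<Longrightarrow> c \<in> X \<Longrightarrow>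
      (\<Sum>i\<in>I. \<Sum>a\<in>X. cnj (M i a b) * M i a c) = (if b = c then 1 else 0)"
  shows "(\<Sum>i\<in>I. \<Sum>a\<in>X. (\<Sum>b\<in>X. M i a b * u b) * cnj (\<Sum>c\<in>X. M i a c * v c)) =
    (\<Sum>b\<in>X. u b * cnj (v b))"
proof -
  let ?t = "\<lambda>i a b c. u b * cnj (v c) * (cnj (M i a c) * M i a b)"
  have "(\<Sum>i\<in>I. \<Sum>a\<in>X. (\<Sum>b\<in>X. M i a b * u b) * cnj (\<Sum>c\<in>X. M i a c * v c)) =
     (\<Sum>i\<in>I. \<Sum>a\<in>X. \<Sum>b\<in>X. \<Sum>c\<in>X. ?t i a b c)"
    by (simp add: sum_product mult_ac)
  also have "\<dots> = (\<Sum>i\<in>I. \<Sum>b\<in>X. \<Sum>a\<in>X. \<Sum>c\<in>X. ?t i a b c)"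
    by (rule sum.cong[OF refl], rule sum.swap)
  also have "\<dots> = (\<Sum>b\<in>X. \<Sum>i\<in>I. \<Sum>a\<in>X. \<Sum>c\<in>X. ?t i a b c)"
    by (rule sum.swap)
  also have "\<dots> = (\<Sum>b\<in>X. \<Sum>i\<in>I. \<Sum>c\<in>X. \<Sum>a\<in>X. ?t i a b c)"
    by (rule sum.cong[OF refl], rule sum.cong[OF refl], rule sum.swap)
  also have "\<dots> = (\<Sum>b\<in>X. \<Sum>c\<in>X. \<Sum>i\<in>I. \<Sum>a\<in>X. ?t i a b c)"
    by (rule sum.cong[OF refl], rule sum.swap)
  also have "\<dots> = (\<Sum>b\<in>X. \<Sum>c\<in>X. if c = b then u b * cnj (v c) else 0)"
    unfolding sum_distrib_left[symmetric] by (intro sum.cong refl) (simp add: M)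
  also have "\<dots> = (\<Sum>b\<in>X. u b * cnj (v b))"
    using assms(1) by (simp add: sum.delta)
  finally show ?thesis .
qed

section \<open>Splitting off one coordinate of the product basis\<close>

lemma configs_insert:
  assumes "j \<in> J"
  shows "bij_betw (\<lambda>(a, r). r(j := a)) ({..<D j} \<times> configs D (J - {j})) (configs D J)"
proof -
  have "configs D J = (\<lambda>(a, r). r(j := a)) ` ({..<D j} \<times> configs D (J - {j}))"
    unfolding configs_def
    using PiE_insert_eq[of j "J - {j}" "\<lambda>k. {..<D k}", unfolded insert_Diff[OF assms]] .
  moreover have "inj_on (\<lambda>(a, r). r(j := a)) ({..<D j} \<times> configs D (J - {j}))"
  proof (intro inj_onI, clarify)
    fix a b r s
    assume rs: "r \<in> configs D (J - {j})" "s \<in> configs D (J - {j})" and eq: "r(j := a) = s(j := b)"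
    \<comment> \<open>Extensional functions carry no information at \<open>j\<close>, so overwriting
      that value loses nothing.\<close>
    have "r j = undefined" "s j = undefined"
      using rs PiE_arb[of _ "J - {j}" "\<lambda>k. {..<D k}" j] by (simp_all add: configs_def)
    then have "r x = s x" for x
      using fun_cong[OF eq, of x] by (cases "x = j") auto
    then show "a = b \<and> r = s" using fun_cong[OF eq, of j] by auto
  qed
  ultimately show ?thesis by (simp add: bij_betw_def)
qed

lemma sum_configs:
  fixes f :: "(nat \<Rightarrow> nat) \<Rightarrow> 'c::comm_monoid_add"
  assumes "j \<in> J"
  shows "(\<Sum>x\<in>configs D J. f x) = (\<Sum>a<D j. \<Sum>r\<in>configs D (J - {j}). f (r(j := a)))"
  using sum.reindex_bij_betw[OF configs_insert[OF assms], of f D]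
  by (simp add: case_prod_unfold sum.cartesian_product)

lemma finite_configs: "finite J \<Longrightarrow> finite (configs D J)"
  unfolding configs_def by (intro finite_PiE) auto

lemma configs_upd:
  "j \<in> J \<Longrightarrow> a < D j \<Longrightarrow> r \<in> configs D (J - {j}) \<Longrightarrow> r(j := a) \<in> configs D J"
  using configs_insert[of j J D] by (fastforce simp: bij_betw_def)

lemma restrict_configs: "x \<in> configs D J \<Longrightarrow> K \<subseteq> J \<Longrightarrow> restrict x K \<in> configs D K"
  by (auto simp: configs_def PiE_def Pi_def)

lemma restrict_configs_id: "r \<in> configs D K \<Longrightarrow> restrict r K = r"
  by (simp add: configs_def)

text \<open>The amplitude matrix of a vector across the cut between party \<open>j\<close> and the
  rest, in the form that \<open>gram\<close> and \<open>purity\<close> expect.\<close>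

definition slice :: "nat \<Rightarrow> (nat \<Rightarrow> nat) cvec \<Rightarrow> nat \<Rightarrow> (nat \<Rightarrow> nat) \<Rightarrow> complex" where
  "slice j \<psi> a r = \<psi> (r(j := a))"

definition local_purity :: "nat \<Rightarrow> (nat \<Rightarrow> nat) \<Rightarrow> nat \<Rightarrow> (nat \<Rightarrow> nat) cvec \<Rightarrow> real" where
  "local_purity N D j \<psi> = purity {..<D j} (rest N D j) (slice j \<psi>)"

lemma vec_norm_squared: "(vec_norm I v)\<^sup>2 = (\<Sum>x\<in>I. (cmod (v x))\<^sup>2)"
  by (simp add: vec_norm_def L2_set_def sum_nonneg)

lemma vec_norm_slice:
  assumes "j \<in> {1..N}"
  shows "(vec_norm (whole N D) \<psi>)\<^sup>2 = weight {..<D j} (rest N D j) (slice j \<psi>)"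
  unfolding vec_norm_squared weight_def slice_def by (rule sum_configs[OF assms])

lemma gram_scale: "gram B (\<lambda>a r. c * \<Psi> a r) a b = complex_of_real ((cmod c)\<^sup>2) * gram B \<Psi> a b"
  unfolding gram_def complex_norm_square by (simp add: sum_distrib_left mult_ac)

text \<open>The purity is quadratic in the reduced state, hence of degree four in the vector. This
  removes global phases and accounts for normalization.\<close>

lemma purity_scale: "purity A B (\<lambda>a r. c * \<Psi> a r) = cmod c ^ 4 * purity A B \<Psi>"
  unfolding purity_def hs_norm2_def gram_scale
  by (simp add: norm_mult power_mult_distrib norm_power sum_distrib_left flip: power_mult)

lemma local_purity_scale: "local_purity N D j (\<lambda>x. c * \<psi> x) = cmod c ^ 4 * local_purity N D j \<psi>"
  unfolding local_purity_def purity_scale[symmetric] by (simp add: slice_def[abs_def])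

lemma local_apply_eq:
  assumes k: "k \<in> {1..N}" and x: "x \<in> whole N D"
  shows "local_apply N D k M v x = (\<Sum>b<D k. M (x k) b * v (x(k := b)))"
proof -
  let ?R = "restrict x ({1..N} - {k})"
  have R: "?R \<in> rest N D k" using x by (rule restrict_configs) auto
  have upd: "?R(k := b) = x(k := b)" for b
    using x k by (auto simp: fun_eq_iff configs_def PiE_def extensional_def)
  have "local_apply N D k M v x = (\<Sum>y\<in>whole N D. tensor_op N k M op_id x y * v y)"
    using x by (simp add: local_apply_def op_apply_def)
  also have "\<dots> = (\<Sum>b<D k. \<Sum>r\<in>rest N D k.
      tensor_op N k M op_id x (r(k := b)) * v (r(k := b)))"
    by (rule sum_configs[OF k])
  \<comment> \<open>The identity on the rest leaves only the summand whose rest part agrees with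
    that of \<open>x\<close>.\<close>
  also have "\<dots> = (\<Sum>b<D k. \<Sum>r\<in>rest N D k.
      if r = ?R then M (x k) b * v (?R(k := b)) else 0)"
    by (intro sum.cong refl) (auto simp: tensor_op_def op_id_def restrict_configs_id)
  also have "\<dots> = (\<Sum>b<D k. M (x k) b * v (x(k := b)))"
    using R by (simp add: finite_configs upd)
  finally show ?thesis .
qed

section \<open>Purity under a local measurement\<close>

text \<open>No signalling: an action at \<open>k\<close> does not change the averaged state of
  another party. The rest of \<open>j\<close> is split into the coordinate of \<open>k\<close> and a
  remainder \<open>t\<close>; for each fixed \<open>t\<close>, \<open>kraus_preserves_inner\<close>
  applies.\<close>

lemma gram_local_apply_other:
  fixes M :: "'i \<Rightarrow> nat cop"
  assumes j: "j \<in> {1..N}" and k: "k \<in> {1..N}" and "j \<noteq> k"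
    and M: "\<And>b c. b < D k \<Longrightarrow> c < D k \<Longrightarrow>
      (\<Sum>i\<in>I. \<Sum>a<D k. cnj (M i a b) * M i a c) = (if b = c then 1 else 0)"
    and ab: "a < D j" "b < D j"
  shows "gram (rest N D j) (slice j \<psi>) a b =
    (\<Sum>i\<in>I. gram (rest N D j) (slice j (local_apply N D k (M i) \<psi>)) a b)"
proof -
  let ?T = "configs D ({1..N} - {j} - {k})"
  have kj: "k \<in> {1..N} - {j}" using k \<open>j \<noteq> k\<close> by auto
  have split: "gram (rest N D j) (slice j \<xi>) a b =
      (\<Sum>t\<in>?T. \<Sum>c<D k. \<xi> (t(k := c, j := a)) * cnj (\<xi> (t(k := c, j := b))))" for \<xi>
    unfolding gram_def slice_def by (subst sum_configs[OF kj], rule sum.swap)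
  have app: "local_apply N D k (M i) \<psi> (t(k := c, j := e)) =
      (\<Sum>d<D k. M i c d * \<psi> (t(k := d, j := e)))" if "t \<in> ?T" "c < D k" "e < D j" for i t c e
  proof -
    have "t(k := c, j := e) \<in> whole N D"
      using configs_upd[of k "{1..N} - {j}" c D t] configs_upd[of j "{1..N}" e D "t(k := c)"] that j kj by simp
    moreover have "t(k := c, j := e, k := d) = t(k := d, j := e)" for d
      using \<open>j \<noteq> k\<close> by (auto simp: fun_eq_iff)
    ultimately show ?thesis
      using \<open>j \<noteq> k\<close> by (simp add: local_apply_eq[OF k])
  qed
  have "(\<Sum>i\<in>I. gram (rest N D j) (slice j (local_apply N D k (M i) \<psi>)) a b) =
     (\<Sum>i\<in>I. \<Sum>t\<in>?T. \<Sum>c<D k. (\<Sum>d<D k. M i c d * \<psi> (t(k := d, j := a))) *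
        cnj (\<Sum>d<D k. M i c d * \<psi> (t(k := d, j := b))))"
    unfolding split using ab by (intro sum.cong refl) (simp add: app)
  also have "\<dots> = (\<Sum>t\<in>?T. \<Sum>i\<in>I. \<Sum>c<D k. (\<Sum>d<D k. M i c d * \<psi> (t(k := d, j := a))) *
        cnj (\<Sum>d<D k. M i c d * \<psi> (t(k := d, j := b))))"
    by (rule sum.swap)
  also have "\<dots> = gram (rest N D j) (slice j \<psi>) a b"
    unfolding split by (rule sum.cong[OF refl], rule kraus_preserves_inner) (auto simp: M)
  finally show ?thesis by simp
qed

text \<open>No signalling seen from the complement: when \<open>j\<close> itself measures, it is the
  reduced state of the rest that is preserved on average, hence the exchanged arguments.\<close>

lemma gram_local_apply_same:
  fixes M :: "'i \<Rightarrow> nat cop"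
  assumes j: "j \<in> {1..N}"
    and M: "\<And>b c. b < D j \<Longrightarrow> c < D j \<Longrightarrow>
      (\<Sum>i\<in>I. \<Sum>a<D j. cnj (M i a b) * M i a c) = (if b = c then 1 else 0)"
    and rs: "r \<in> rest N D j" "s \<in> rest N D j"
  shows "gram {..<D j} (\<lambda>r a. slice j \<psi> a r) r s =
    (\<Sum>i\<in>I. gram {..<D j} (\<lambda>r a. slice j (local_apply N D j (M i) \<psi>) a r) r s)"
proof -
  have app: "slice j (local_apply N D j (M i) \<psi>) a r = (\<Sum>b<D j. M i a b * slice j \<psi> b r)"
    if "a < D j" "r \<in> rest N D j" for i a r
    using local_apply_eq[OF j configs_upd[OF j that]] by (simp add: slice_def)
  have "(\<Sum>i\<in>I. gram {..<D j} (\<lambda>r a. slice j (local_apply N D j (M i) \<psi>) a r) r s) =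
    (\<Sum>i\<in>I. \<Sum>a<D j. (\<Sum>b<D j. M i a b * slice j \<psi> b r) * cnj (\<Sum>b<D j. M i a b * slice j \<psi> b s))"
    unfolding gram_def using rs by (intro sum.cong refl) (simp add: app)
  also have "\<dots> = gram {..<D j} (\<lambda>r a. slice j \<psi> a r) r s"
    unfolding gram_def by (rule kraus_preserves_inner) (auto simp: M)
  finally show ?thesis by simp
qed

lemma local_purity_measurement:
  fixes M :: "'i \<Rightarrow> nat cop"
  assumes j: "j \<in> {1..N}" and k: "k \<in> {1..N}"
    and M: "\<And>b c. b < D k \<Longrightarrow> c < D k \<Longrightarrow>
      (\<Sum>i\<in>I. \<Sum>a<D k. cnj (M i a b) * M i a c) = (if b = c then 1 else 0)"
  shows "local_purity N D j \<psi> \<le> (vec_norm (whole N D) \<psi>)\<^sup>2 *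
    (\<Sum>i\<in>I. local_purity N D j (local_apply N D k (M i) \<psi>) /
      (vec_norm (whole N D) (local_apply N D k (M i) \<psi>))\<^sup>2)"
proof (cases "j = k")
  case True
  have fin: "finite {..<D j}" "finite (rest N D j)" by (simp_all add: finite_configs)
  show ?thesis
    \<comment> \<open>The state of the measuring party is not preserved on average, so purity and
      weight are first moved to the complement.\<close>
    unfolding local_purity_def vec_norm_slice[OF j] purity_flip[of "{..<D j}"]
      weight_flip[of "{..<D j}"]
    using M[folded True] j True fin
    by (intro purity_convex) (auto intro: gram_local_apply_same)
next
  case False
  then show ?thesis
    unfolding local_purity_def vec_norm_slice[OF j]
    using M j k by (intro purity_convex) (auto intro: gram_local_apply_other simp: finite_configs)
qed

text \<open>The probabilities are traces of the reduced states of the complement of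
  \<open>k\<close>, whose sum is preserved.\<close>

lemma sum_vec_norm_local_apply:
  fixes M :: "'i \<Rightarrow> nat cop"
  assumes k: "k \<in> {1..N}"
    and M: "\<And>b c. b < D k \<Longrightarrow> c < D k \<Longrightarrow>
      (\<Sum>i\<in>I. \<Sum>a<D k. cnj (M i a b) * M i a c) = (if b = c then 1 else 0)"
  shows "(\<Sum>i\<in>I. (vec_norm (whole N D) (local_apply N D k (M i) \<psi>))\<^sup>2) = (vec_norm (whole N D) \<psi>)\<^sup>2"
proof -
  have "complex_of_real (\<Sum>i\<in>I. (vec_norm (whole N D) (local_apply N D k (M i) \<psi>))\<^sup>2) =
      complex_of_real ((vec_norm (whole N D) \<psi>)\<^sup>2)"
    unfolding of_real_sum vec_norm_slice[OF k] weight_flip[of "{..<D k}"] of_real_weight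
    using M by (subst sum.swap) (simp add: gram_local_apply_same[OF k, symmetric])
  then show ?thesis by (simp only: of_real_eq_iff)
qed

lemma vec_norm_normalized: "vec_norm I v \<noteq> 0 \<Longrightarrow> vec_norm I (normalized I v) = 1"
proof -
  assume "vec_norm I v \<noteq> 0"
  then have "(vec_norm I (normalized I v))\<^sup>2 = 1"
    by (simp add: vec_norm_squared normalized_def norm_divide power_divide
        flip: sum_divide_distrib) (metis vec_norm_squared divide_self_if power_not_zero)
  then show ?thesis
    by (metis L2_set_nonneg abs_of_nonneg real_sqrt_abs real_sqrt_one vec_norm_def)
qed

lemma local_purity_normalized:
  "local_purity N D j (normalized (whole N D) v) = local_purity N D j v / vec_norm (whole N D) v ^ 4"
  using local_purity_scale[of N D j "1 / complex_of_real (vec_norm (whole N D) v)" v]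
  by (simp add: normalized_def norm_divide power_divide)

section \<open>Induction over LOCC protocols\<close>

text \<open>A nonzero probability means that the last outcome had a nonzero vector, so its
  normalization is a genuine one.\<close>

lemma vec_norm_locc_state:
  assumes "vec_norm (whole N D) \<psi> = 1" and "locc_prob N D party kraus \<psi> h \<noteq> 0"
  shows "vec_norm (whole N D) (locc_state N D party kraus \<psi> h) = 1"
  using assms by (cases h) (auto intro!: vec_norm_normalized split: if_splits)

text \<open>Backward induction on the number of remaining rounds: the purity at a history is at most
  the average over its successors, each of which is bounded by \<open>q\<close>.\<close>

lemma local_purity_locc_state_le:
  assumes prot: "locc_protocol N D n party kraus"
    and \<psi>: "vec_norm (whole N D) \<psi> = 1"
    and j: "j \<in> {1..N}"
    and final: "\<And>h. length h = n \<Longrightarrow> locc_prob N D party kraus \<psi> h \<noteq> 0 \<Longrightarrow>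
      local_purity N D j (locc_state N D party kraus \<psi> h) \<le> q"
    and "length h \<le> n" and "locc_prob N D party kraus \<psi> h \<noteq> 0"
  shows "local_purity N D j (locc_state N D party kraus \<psi> h) \<le> q"
  using \<open>length h \<le> n\<close> \<open>locc_prob N D party kraus \<psi> h \<noteq> 0\<close>
proof (induction "n - length h" arbitrary: h)
  case 0
  then show ?case using final by auto
next
  case (Suc m)
  let ?S = "locc_state N D party kraus \<psi>"
  let ?k = "party h"
  let ?M = "\<lambda>i. kraus h ! i"
  let ?v = "\<lambda>i. local_apply N D ?k (?M i) (?S h)"
  let ?p = "\<lambda>i. (vec_norm (whole N D) (?v i))\<^sup>2"
  have "length h < n" using Suc by auto
  then have k: "?k \<in> {1..N}"
    and M: "\<And>b c. b < D ?k \<Longrightarrow> c < D ?k \<Longrightarrow>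
      (\<Sum>i<length (kraus h). \<Sum>a<D ?k. cnj (?M i a b) * ?M i a c) = (if b = c then 1 else 0)"
    using prot by (auto simp: locc_protocol_def op_mult_def op_adj_def op_id_def)
  have n1: "vec_norm (whole N D) (?S h) = 1"
    using Suc.prems(2) by (rule vec_norm_locc_state[OF \<psi>])
  have "local_purity N D j (?S h) \<le> (\<Sum>i<length (kraus h). local_purity N D j (?v i) / ?p i)"
    using local_purity_measurement[where D = D and M = ?M and \<psi> = "?S h", OF j k M] n1 by simp
  also have "\<dots> \<le> (\<Sum>i<length (kraus h). ?p i * q)"
  proof (rule sum_mono)
    fix i assume "i \<in> {..<length (kraus h)}"
    then have i: "i < length (kraus h)" by simp
    show "local_purity N D j (?v i) / ?p i \<le> ?p i * q"
    \<comment> \<open>An outcome of probability zero gives \<open>0\<close> on both sides, by the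
      convention for division by zero.\<close>
    proof (cases "?p i = 0")
      case False
      have "local_purity N D j (?S (i # h)) \<le> q"
        using Suc False i by (intro Suc.hyps(1)) auto
      then have "?p i * local_purity N D j (?S (i # h)) \<le> ?p i * q"
        by (intro mult_left_mono) auto
      \<comment> \<open>Normalizing divides the degree-four purity by the square of
        \<open>?p i\<close>; one factor cancels.\<close>
      moreover have "?p i * local_purity N D j (?S (i # h)) = local_purity N D j (?v i) / ?p i"
        using False by (simp add: local_purity_normalized field_simps power2_eq_square power4_eq_xxxx)
      ultimately show ?thesis by simp
    qed simp
  qed
  also have "\<dots> = q"
    using sum_vec_norm_local_apply[where D = D and M = ?M and \<psi> = "?S h", OF k M] n1
    by (simp flip: sum_distrib_right)
  finally show ?case .
qed

lemma local_purity_locc_transformable: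
  assumes "locc_transformable N D \<psi> \<phi>" and "vec_norm (whole N D) \<psi> = 1" and "j \<in> {1..N}"
  shows "local_purity N D j \<psi> \<le> local_purity N D j \<phi>"
proof -
  obtain n party kraus where prot: "locc_protocol N D n party kraus"
    and fin: "\<And>h. length h = n \<Longrightarrow> locc_prob N D party kraus \<psi> h \<noteq> 0 \<Longrightarrow>
      \<exists>c. cmod c = 1 \<and> locc_state N D party kraus \<psi> h = (\<lambda>x. c * \<phi> x)"
    using assms(1) by (auto simp: locc_transformable_def)
  have "local_purity N D j (locc_state N D party kraus \<psi> h) \<le> local_purity N D j \<phi>"
    if "length h = n" "locc_prob N D party kraus \<psi> h \<noteq> 0" for h
    using fin[OF that] by (auto simp: local_purity_scale)
  from local_purity_locc_state_le[OF prot assms(2,3) this, of "[]"] show ?thesis by simp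
qed

section \<open>Maximization over observables\<close>

text \<open>The unnormalized state of the first factor conditional on finding the second in
  \<open>\<chi>\<close>.\<close>

definition partial_inner :: "'b set \<Rightarrow> ('a \<Rightarrow> 'b \<Rightarrow> complex) \<Rightarrow> ('b \<Rightarrow> complex) \<Rightarrow> 'a \<Rightarrow> complex" where
  "partial_inner B \<Psi> \<chi> a = (\<Sum>r\<in>B. cnj (\<chi> r) * \<Psi> a r)"

definition traceless_observables :: "nat \<Rightarrow> nat cop set" where
  "traceless_observables d = {A. hermitian {..<d} A \<and> op_trace {..<d} A = 0 \<and>
     op_trace {..<d} (op_mult {..<d} A A) = 1}"

lemma observables_eq: "observables N D j = (\<lambda>A. tensor_op N j A op_id) ` traceless_observables (D j)"
  by (auto simp: observables_def traceless_observables_def)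

lemma hs_norm2_observable: "A \<in> traceless_observables d \<Longrightarrow> hs_norm2 {..<d} A = 1"
proof -
  assume A: "A \<in> traceless_observables d"
  then have "complex_of_real (hs_norm2 {..<d} A) = op_trace {..<d} (op_mult {..<d} A A)"
    unfolding of_real_hs_norm2 op_trace_def op_mult_def
    by (intro sum.cong refl) (auto simp: traceless_observables_def hermitian_def op_adj_def)
  then show ?thesis using A by (simp add: traceless_observables_def)
qed

lemma hs_inner_squared_le:
  "(Re (\<Sum>a\<in>X. \<Sum>b\<in>X. T a b * A b a))\<^sup>2 \<le> hs_norm2 X T * hs_norm2 X A"
proof -
  have "\<bar>Re (\<Sum>a\<in>X. \<Sum>b\<in>X. T a b * A b a)\<bar> \<le> cmod (\<Sum>(a,b)\<in>X\<times>X. T a b * A b a)"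
    unfolding sum.cartesian_product by (rule abs_Re_le_cmod)
  also have "\<dots> \<le> (\<Sum>(a,b)\<in>X\<times>X. cmod (T a b) * cmod (A b a))"
    by (rule order.trans[OF norm_sum]) (simp add: case_prod_unfold norm_mult)
  finally have "(Re (\<Sum>a\<in>X. \<Sum>b\<in>X. T a b * A b a))\<^sup>2 \<le> (\<Sum>(a,b)\<in>X\<times>X. cmod (T a b) * cmod (A b a))\<^sup>2"
    by (rule power2_le_iff_abs_le[THEN iffD2, rotated]) (auto intro: sum_nonneg)
  also have "\<dots> \<le> (\<Sum>(a,b)\<in>X\<times>X. (cmod (T a b))\<^sup>2) * (\<Sum>(a,b)\<in>X\<times>X. (cmod (A b a))\<^sup>2)"
    unfolding case_prod_unfold by (rule Cauchy_Schwarz_ineq_sum)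
  also have "\<dots> = hs_norm2 X T * hs_norm2 X A"
    unfolding hs_norm2_def sum.cartesian_product[symmetric]
    by (subst (2) sum.swap) simp
  finally show ?thesis .
qed

text \<open>Needed for the degenerate case \<open>T = 0\<close> of the maximization, where
  \<open>T\<close> cannot be normalized. The witness is diagonal with entries 1 and -1 over the
  square root of 2, which takes two levels.\<close>

lemma traceless_observables_nonempty:
  assumes "2 \<le> d"
  shows "traceless_observables d \<noteq> {}"
proof -
  let ?s = "complex_of_real (1 / sqrt 2)"
  let ?f = "\<lambda>x::nat. if x = 0 then ?s else if x = 1 then - ?s else 0"
  let ?A = "\<lambda>x y::nat. if x = y then ?f x else 0"
  have s: "?s * ?s = 1 / 2"
    by (simp flip: of_real_mult)
  have sub: "{0, 1} \<subseteq> {..<d}" using assms by auto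
  have "op_trace {..<d} ?A = (\<Sum>x\<in>{0,1}. ?f x)"
    unfolding op_trace_def using sub by (intro sum.mono_neutral_cong_right) auto
  moreover have "op_trace {..<d} (op_mult {..<d} ?A ?A) = (\<Sum>x<d. ?f x * ?f x)"
    unfolding op_trace_def op_mult_def
  proof (rule sum.cong[OF refl])
    fix x assume "x \<in> {..<d}"
    have "(\<Sum>z<d. ?A x z * ?A z x) = (\<Sum>z<d. if z = x then ?f x * ?f x else 0)"
      by (intro sum.cong refl) auto
    then show "(\<Sum>z<d. ?A x z * ?A z x) = ?f x * ?f x"
      using \<open>x \<in> {..<d}\<close> by (simp only: sum.delta finite_lessThan if_True)
  qed
  moreover have "(\<Sum>x<d. ?f x * ?f x) = (\<Sum>x\<in>{0,1}. ?f x * ?f x)"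
    using sub by (intro sum.mono_neutral_right) auto
  moreover have "(\<Sum>x\<in>{0,1}. ?f x * ?f x) = ?s * ?s + ?s * ?s" by simp
  moreover have "(\<Sum>x\<in>{0,1}. ?f x) = 0" by simp
  ultimately have "?A \<in> traceless_observables d"
    unfolding traceless_observables_def s by (auto simp: hermitian_def op_adj_def)
  then show ?thesis by blast
qed

text \<open>Equality in Cauchy--Schwarz occurs at \<open>T\<close> divided by its norm, which is an
  admissible observable because \<open>T\<close> is Hermitian and traceless.\<close>

lemma hs_inner_max_attained:
  assumes "2 \<le> d" and T: "hermitian {..<d} T" "op_trace {..<d} T = 0"
  shows "\<exists>A\<in>traceless_observables d. (Re (\<Sum>a<d. \<Sum>b<d. T a b * A b a))\<^sup>2 = hs_norm2 {..<d} T"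
proof (cases "hs_norm2 {..<d} T = 0")
  case True
  obtain A where "A \<in> traceless_observables d"
    using traceless_observables_nonempty[OF assms(1)] by blast
  then show ?thesis
    using hs_inner_squared_le[of T A "{..<d}"] True by (intro bexI[of _ A]) simp_all
next
  case False
  let ?h = "hs_norm2 {..<d} T"
  have h: "0 < ?h" using False hs_norm2_nonneg[of "{..<d}" T] by linarith
  have TT: "(\<Sum>a<d. \<Sum>b<d. T a b * T b a) = complex_of_real ?h"
    unfolding of_real_hs_norm2 using T(1) by (intro sum.cong refl) (auto simp: hermitian_def op_adj_def)
  let ?A = "\<lambda>a b. T a b / complex_of_real (sqrt ?h)"
  have ss: "complex_of_real (sqrt ?h) * complex_of_real (sqrt ?h) = complex_of_real ?h"
    using h by (simp flip: of_real_mult)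
  have "op_trace {..<d} (op_mult {..<d} ?A ?A) = (\<Sum>a<d. \<Sum>b<d. T a b * T b a) / complex_of_real ?h"
    unfolding op_trace_def op_mult_def by (simp add: ss sum_divide_distrib)
  also have "\<dots> = 1" unfolding TT using h by simp
  finally have "?A \<in> traceless_observables d"
    using T by (auto simp: traceless_observables_def hermitian_def op_adj_def op_trace_def
        simp flip: sum_divide_distrib)
  moreover have "(\<Sum>a<d. \<Sum>b<d. T a b * ?A b a) = complex_of_real (?h / sqrt ?h)"
    using TT by (simp flip: sum_divide_distrib)
  then have "(Re (\<Sum>a<d. \<Sum>b<d. T a b * ?A b a))\<^sup>2 = ?h"
    using h by (simp add: power_divide power2_eq_square)
  ultimately show ?thesis by (intro bexI[of _ ?A])
qed

lemma Greatest_hs_inner: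
  assumes "2 \<le> d" and T: "hermitian {..<d} T" "op_trace {..<d} T = 0"
  shows "(GREATEST r. r \<in> (\<lambda>A. (Re (\<Sum>a<d. \<Sum>b<d. T a b * A b a))\<^sup>2) ` traceless_observables d)
    = hs_norm2 {..<d} T"
proof (rule Greatest_equality)
  show "hs_norm2 {..<d} T \<in> (\<lambda>A. (Re (\<Sum>a<d. \<Sum>b<d. T a b * A b a))\<^sup>2) ` traceless_observables d"
    using hs_inner_max_attained[OF assms] by force
next
  fix r assume "r \<in> (\<lambda>A. (Re (\<Sum>a<d. \<Sum>b<d. T a b * A b a))\<^sup>2) ` traceless_observables d"
  then show "r \<le> hs_norm2 {..<d} T"
    using hs_inner_squared_le[of T _ "{..<d}"] by (metis (lifting) hs_norm2_observable imageE mult.right_neutral)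
qed

section \<open>Orthonormal bases of the rest of the system\<close>

text \<open>Only \<open>u\<close> is expanded: orthonormality identifies its coefficients, and
  pairing the expansion with \<open>v\<close> gives the sum.\<close>

lemma parseval:
  assumes B: "orthonormal_basis I B" and u: "u \<in> hilb I"
  shows "(\<Sum>\<chi>\<in>B. vec_inner I \<chi> u * cnj (vec_inner I \<chi> v)) = (\<Sum>x\<in>I. u x * cnj (v x))"
proof -
  have fin: "finite B" and on: "\<And>\<chi> \<chi>'. \<chi> \<in> B \<Longrightarrow> \<chi>' \<in> B \<Longrightarrow> vec_inner I \<chi> \<chi>' = (if \<chi> = \<chi>' then 1 else 0)"
    using B by (auto simp: orthonormal_basis_def)
  obtain c where c: "u = (\<lambda>x. \<Sum>\<chi>\<in>B. c \<chi> * \<chi> x)"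
    using B u by (auto simp: orthonormal_basis_def)
  have cu: "vec_inner I \<chi> u = c \<chi>" if "\<chi> \<in> B" for \<chi>
  proof -
    have "vec_inner I \<chi> u = (\<Sum>x\<in>I. \<Sum>\<chi>'\<in>B. c \<chi>' * (cnj (\<chi> x) * \<chi>' x))"
      by (simp add: vec_inner_def c sum_distrib_left mult_ac)
    also have "\<dots> = (\<Sum>\<chi>'\<in>B. c \<chi>' * vec_inner I \<chi> \<chi>')"
      by (subst sum.swap) (simp add: vec_inner_def sum_distrib_left)
    also have "\<dots> = (\<Sum>\<chi>'\<in>B. if \<chi>' = \<chi> then c \<chi>' else 0)"
      using that by (intro sum.cong refl) (auto simp: on)
    finally show ?thesis using that fin by simp
  qed
  have "(\<Sum>x\<in>I. u x * cnj (v x)) = (\<Sum>x\<in>I. \<Sum>\<chi>\<in>B. c \<chi> * (\<chi> x * cnj (v x)))"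
    by (simp add: c sum_distrib_right mult.assoc)
  also have "\<dots> = (\<Sum>\<chi>\<in>B. c \<chi> * cnj (vec_inner I \<chi> v))"
    by (subst sum.swap) (simp add: vec_inner_def sum_distrib_left)
  finally show ?thesis by (simp add: cu)
qed

text \<open>The conditional states add up to the reduced state for every basis, which is why the
  choice of measurement will not matter.\<close>

lemma sum_partial_inner:
  assumes "orthonormal_basis R B"
  shows "(\<Sum>\<chi>\<in>B. partial_inner R \<Psi> \<chi> a * cnj (partial_inner R \<Psi> \<chi> b)) = gram R \<Psi> a b"
proof -
  \<comment> \<open>Rows of \<open>\<Psi>\<close> may be nonzero outside \<open>R\<close>;
    truncation puts them into \<open>hilb R\<close>.\<close>
  let ?u = "\<lambda>a r. if r \<in> R then \<Psi> a r else 0"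
  have "vec_inner R \<chi> (?u a) = partial_inner R \<Psi> \<chi> a" for \<chi> a
    by (simp add: vec_inner_def partial_inner_def cong: sum.cong)
  moreover have "?u a \<in> hilb R" by (simp add: hilb_def)
  ultimately show ?thesis
    using parseval[OF assms, of "?u a" "?u b"] by (simp add: gram_def)
qed

text \<open>Guarantees that some projective measurement exists, so that the maximum over
  measurements is taken over a nonempty set.\<close>

lemma standard_basis:
  assumes "finite I"
  shows "orthonormal_basis I ((\<lambda>z x. if x = z then 1 else 0) ` I)"
proof -
  let ?e = "\<lambda>z x. if x = z then 1 else 0 :: complex"
  have inj: "inj_on ?e I" by (auto simp: inj_on_def fun_eq_iff split: if_splits)
  have eq: "?e z = ?e w \<longleftrightarrow> z = w" for z w by (auto simp: fun_eq_iff split: if_splits)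
  have inn: "vec_inner I (?e z) v = v z" if "z \<in> I" for z v
  proof -
    have "vec_inner I (?e z) v = (\<Sum>x\<in>I. if x = z then v x else 0)"
      unfolding vec_inner_def by (intro sum.cong refl) auto
    then show ?thesis using that assms by simp
  qed
  have "v = (\<lambda>x. \<Sum>u\<in>?e ` I. vec_inner I u v * u x)" if v: "v \<in> hilb I" for v
  proof
    fix x
    have "(\<Sum>u\<in>?e ` I. vec_inner I u v * u x) = (\<Sum>z\<in>I. vec_inner I (?e z) v * ?e z x)"
      by (simp add: sum.reindex[OF inj])
    also have "\<dots> = (\<Sum>z\<in>I. if z = x then v z else 0)"
      by (intro sum.cong refl) (auto simp: inn)
    also have "\<dots> = v x" using v assms by (auto simp: hilb_def)
    finally show "v x = (\<Sum>u\<in>?e ` I. vec_inner I u v * u x)" by simp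
  qed
  then have "\<forall>v\<in>hilb I. \<exists>c. v = (\<lambda>x. \<Sum>u\<in>?e ` I. c u * u x)"
    by (intro ballI exI)
  moreover have "\<forall>u\<in>?e ` I. \<forall>v\<in>?e ` I. vec_inner I u v = (if u = v then 1 else 0)"
    by (auto simp: inn eq)
  ultimately show ?thesis
    using assms by (auto simp: orthonormal_basis_def hilb_def)
qed

section \<open>Expectation values and the maximal disturbance\<close>

lemma sum_configs_tensor:
  assumes "j \<in> {1..N}"
  shows "(\<Sum>x\<in>whole N D. f x (x j) (restrict x ({1..N} - {j}))) =
    (\<Sum>a<D j. \<Sum>r\<in>rest N D j. f (r(j := a)) a r)"
  by (subst sum_configs[OF assms]) (simp add: restrict_configs_id)

lemma expval_ketbra_local:
  assumes j: "j \<in> {1..N}"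
  shows "expval N D (ketbra \<psi> \<psi>) (tensor_op N j A op_id) =
    Re (\<Sum>a<D j. \<Sum>b<D j. gram (rest N D j) (slice j \<psi>) a b * A b a)"
proof -
  let ?R = "rest N D j"
  have "(\<Sum>y\<in>whole N D. ketbra \<psi> \<psi> (r(j := a)) y * tensor_op N j A op_id y (r(j := a))) =
     (\<Sum>b<D j. \<psi> (r(j := a)) * cnj (\<psi> (r(j := b))) * A b a)" if r: "r \<in> ?R" for r a
  proof -
    have "(\<Sum>y\<in>whole N D. ketbra \<psi> \<psi> (r(j := a)) y * tensor_op N j A op_id y (r(j := a))) =
      (\<Sum>b<D j. \<Sum>s\<in>?R. if s = r then \<psi> (r(j := a)) * cnj (\<psi> (r(j := b))) * A b a else 0)"
      unfolding ketbra_def tensor_op_def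
      by (subst sum_configs[OF j], intro sum.cong refl) (auto simp: op_id_def restrict_configs_id restrict_configs_id[OF r])
    then show ?thesis using r by (simp add: finite_configs)
  qed
  then have "op_trace (whole N D) (op_mult (whole N D) (ketbra \<psi> \<psi>) (tensor_op N j A op_id)) =
      (\<Sum>a<D j. \<Sum>r\<in>?R. \<Sum>b<D j. \<psi> (r(j := a)) * cnj (\<psi> (r(j := b))) * A b a)"
    unfolding op_trace_def op_mult_def by (subst sum_configs[OF j]) simp
  also have "\<dots> = (\<Sum>a<D j. \<Sum>b<D j. gram ?R (slice j \<psi>) a b * A b a)"
    unfolding gram_def slice_def sum_distrib_right
    by (rule sum.cong[OF refl], rule sum.swap)
  finally show ?thesis by (simp only: expval_def)
qed

text \<open>Projecting yields the product of the conditional vector of party \<open>j\<close> with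
  \<open>\<chi>\<close>.\<close>

lemma projector_apply:
  assumes j: "j \<in> {1..N}" and x: "x \<in> whole N D"
  shows "(\<Sum>y\<in>whole N D. tensor_op N j op_id (ketbra \<chi> \<chi>) x y * \<psi> y) =
    \<chi> (restrict x ({1..N} - {j})) * partial_inner (rest N D j) (slice j \<psi>) \<chi> (x j)"
proof -
  have xj: "x j < D j" using x j by (auto simp: configs_def PiE_def Pi_def)
  have "(\<Sum>y\<in>whole N D. tensor_op N j op_id (ketbra \<chi> \<chi>) x y * \<psi> y) =
    (\<Sum>b<D j. if b = x j then \<Sum>r\<in>rest N D j.
       \<chi> (restrict x ({1..N} - {j})) * (cnj (\<chi> r) * \<psi> (r(j := b))) else 0)"
    unfolding tensor_op_def op_id_def ketbra_def
    by (subst sum_configs[OF j], intro sum.cong refl)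
       (auto simp: restrict_configs_id mult.assoc intro!: sum.cong)
  also have "\<dots> = \<chi> (restrict x ({1..N} - {j})) * partial_inner (rest N D j) (slice j \<psi>) \<chi> (x j)"
    using xj by (simp add: partial_inner_def slice_def sum_distrib_left)
  finally show ?thesis .
qed

lemma expval_projector:
  assumes j: "j \<in> {1..N}"
  shows "expval N D (ketbra \<psi> \<psi>) (tensor_op N j op_id (ketbra \<chi> \<chi>)) =
    (\<Sum>a<D j. (cmod (partial_inner (rest N D j) (slice j \<psi>) \<chi> a))\<^sup>2)"
proof -
  let ?P = "tensor_op N j op_id (ketbra \<chi> \<chi>)" and ?e = "partial_inner (rest N D j) (slice j \<psi>) \<chi>"
  have "op_trace (whole N D) (op_mult (whole N D) (ketbra \<psi> \<psi>) ?P) =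
      (\<Sum>y\<in>whole N D. cnj (\<psi> y) * (\<Sum>x\<in>whole N D. ?P y x * \<psi> x))"
    unfolding op_trace_def op_mult_def ketbra_def
    by (subst sum.swap) (simp add: sum_distrib_left mult_ac)
  also have "\<dots> = (\<Sum>y\<in>whole N D. cnj (\<psi> y) * (\<chi> (restrict y ({1..N} - {j})) * ?e (y j)))"
    by (simp add: projector_apply[OF j])
  also have "\<dots> = (\<Sum>a<D j. \<Sum>r\<in>rest N D j. cnj (slice j \<psi> a r) * (\<chi> r * ?e a))"
    unfolding slice_def by (rule sum_configs_tensor[OF j])
  also have "\<dots> = (\<Sum>a<D j. ?e a * (\<Sum>r\<in>rest N D j. \<chi> r * cnj (slice j \<psi> a r)))"
    by (simp add: sum_distrib_left mult_ac)
  also have "\<dots> = (\<Sum>a<D j. ?e a * cnj (?e a))"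
    by (simp add: partial_inner_def)
  also have "\<dots> = complex_of_real (\<Sum>a<D j. (cmod (?e a))\<^sup>2)"
    by (simp only: of_real_sum complex_norm_square)
  finally show ?thesis by (simp add: expval_def)
qed

lemma expval_scale:
  assumes "\<And>x y. x \<in> whole N D \<Longrightarrow> y \<in> whole N D \<Longrightarrow> \<rho> x y = complex_of_real c * \<sigma> x y"
  shows "expval N D \<rho> A = c * expval N D \<sigma> A"
proof -
  have "op_trace (whole N D) (op_mult (whole N D) \<rho> A) =
    complex_of_real c * op_trace (whole N D) (op_mult (whole N D) \<sigma> A)"
    unfolding op_trace_def op_mult_def sum_distrib_left
    by (intro sum.cong refl) (simp add: assms)
  then show ?thesis by (simp add: expval_def)
qed

text \<open>The unnormalized post-measurement operator is the rank-one operator of the product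
  vector \<open>?f\<close>. As \<open>\<chi>\<close> has norm one, its reduced state at
  \<open>j\<close> is the rank-one operator of \<open>e\<close>.\<close>

lemma expval_post_meas_local:
  fixes \<psi> :: "(nat \<Rightarrow> nat) cvec" and \<chi> :: "(nat \<Rightarrow> nat) cvec"
  assumes j: "j \<in> {1..N}" and \<chi>: "vec_inner (rest N D j) \<chi> \<chi> = 1"
  defines "e \<equiv> partial_inner (rest N D j) (slice j \<psi>) \<chi>"
  shows "expval N D (post_meas N D (ketbra \<psi> \<psi>) (tensor_op N j op_id (ketbra \<chi> \<chi>)))
      (tensor_op N j A op_id) =
    Re (\<Sum>a<D j. \<Sum>b<D j. e a * cnj (e b) * A b a) / (\<Sum>a<D j. (cmod (e a))\<^sup>2)"
proof -
  let ?P = "tensor_op N j op_id (ketbra \<chi> \<chi>)"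
  let ?f = "\<lambda>x. \<chi> (restrict x ({1..N} - {j})) * e (x j)"
  have Padj: "?P y x = cnj (?P x y)" for x y
    by (simp add: tensor_op_def op_id_def ketbra_def mult_ac)
  have "op_mult (whole N D) (op_mult (whole N D) ?P (ketbra \<psi> \<psi>)) ?P x y = ketbra ?f ?f x y"
    if "x \<in> whole N D" "y \<in> whole N D" for x y
  proof -
    have "op_mult (whole N D) (op_mult (whole N D) ?P (ketbra \<psi> \<psi>)) ?P x y =
      (\<Sum>z\<in>whole N D. (\<Sum>w\<in>whole N D. ?P x w * \<psi> w) * cnj (?P y z * \<psi> z))"
      unfolding op_mult_def
    proof (rule sum.cong[OF refl])
      fix z
      have "(\<Sum>w\<in>whole N D. ?P x w * ketbra \<psi> \<psi> w z) = (\<Sum>w\<in>whole N D. ?P x w * \<psi> w) * cnj (\<psi> z)"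
        by (simp add: ketbra_def sum_distrib_right mult.assoc)
      then show "(\<Sum>w\<in>whole N D. ?P x w * ketbra \<psi> \<psi> w z) * ?P z y =
          (\<Sum>w\<in>whole N D. ?P x w * \<psi> w) * cnj (?P y z * \<psi> z)"
        using Padj[of z y] by simp
    qed
    also have "\<dots> = (\<Sum>w\<in>whole N D. ?P x w * \<psi> w) * cnj (\<Sum>z\<in>whole N D. ?P y z * \<psi> z)"
      by (simp add: sum_distrib_left)
    also have "\<dots> = ketbra ?f ?f x y"
      unfolding projector_apply[OF j that(1)] projector_apply[OF j that(2)]
      by (simp add: ketbra_def e_def)
    finally show ?thesis .
  qed
  then have "expval N D (post_meas N D (ketbra \<psi> \<psi>) ?P) (tensor_op N j A op_id) =
      1 / expval N D (ketbra \<psi> \<psi>) ?P * expval N D (ketbra ?f ?f) (tensor_op N j A op_id)"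
    by (intro expval_scale) (simp add: post_meas_def)
  moreover have "gram (rest N D j) (slice j ?f) a b = e a * cnj (e b)" for a b
  proof -
    have "gram (rest N D j) (slice j ?f) a b = (\<Sum>r\<in>rest N D j. e a * cnj (e b) * (cnj (\<chi> r) * \<chi> r))"
      unfolding gram_def slice_def by (intro sum.cong refl) (simp add: restrict_configs_id mult_ac)
    then show ?thesis using \<chi> by (simp add: vec_inner_def flip: sum_distrib_left)
  qed
  ultimately show ?thesis
    by (simp add: expval_projector[OF j] expval_ketbra_local[OF j] e_def)
qed

text \<open>The disturbance is the squared trace of \<open>?T\<close> times the local observable,
  where \<open>?T\<close> is the difference of the reduced states before and after the outcome. Both
  have trace one, so \<open>?T\<close> is traceless.\<close>

lemma Greatest_disturbance:
  fixes \<psi> :: "(nat \<Rightarrow> nat) cvec" and \<chi> :: "(nat \<Rightarrow> nat) cvec"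
  assumes j: "j \<in> {1..N}" and d: "2 \<le> D j" and \<psi>: "vec_norm (whole N D) \<psi> = 1"
    and \<chi>: "vec_inner (rest N D j) \<chi> \<chi> = 1"
  defines "e \<equiv> partial_inner (rest N D j) (slice j \<psi>) \<chi>"
  defines "p \<equiv> \<Sum>a<D j. (cmod (e a))\<^sup>2"
  assumes p: "p \<noteq> 0"
  shows "(GREATEST r. r \<in> disturbance N D (ketbra \<psi> \<psi>) (tensor_op N j op_id (ketbra \<chi> \<chi>))
      ` observables N D j) =
    hs_norm2 {..<D j} (\<lambda>a b. gram (rest N D j) (slice j \<psi>) a b - e a * cnj (e b) / complex_of_real p)"
    (is "_ = hs_norm2 _ ?T")
proof -
  let ?G = "gram (rest N D j) (slice j \<psi>)"
  have "disturbance N D (ketbra \<psi> \<psi>) (tensor_op N j op_id (ketbra \<chi> \<chi>)) (tensor_op N j A op_id) =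
      (Re (\<Sum>a<D j. \<Sum>b<D j. ?T a b * A b a))\<^sup>2" for A
  proof -
    have "(\<Sum>a<D j. \<Sum>b<D j. ?T a b * A b a) = (\<Sum>a<D j. \<Sum>b<D j. ?G a b * A b a) -
        (\<Sum>a<D j. \<Sum>b<D j. e a * cnj (e b) * A b a) / complex_of_real p"
      by (simp add: left_diff_distrib sum_subtractf sum_divide_distrib)
    then show ?thesis
      by (simp only: disturbance_def expval_ketbra_local[OF j] expval_post_meas_local[OF j \<chi>]
          minus_complex.simps Re_divide_of_real flip: e_def p_def)
  qed
  then have eq: "disturbance N D (ketbra \<psi> \<psi>) (tensor_op N j op_id (ketbra \<chi> \<chi>)) ` observables N D j =
      (\<lambda>A. (Re (\<Sum>a<D j. \<Sum>b<D j. ?T a b * A b a))\<^sup>2) ` traceless_observables (D j)"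
    unfolding observables_eq image_image by simp
  have "hermitian {..<D j} ?T"
    by (auto simp: hermitian_def op_adj_def gram_def mult_ac)
  moreover have "op_trace {..<D j} ?T = 0"
  proof -
    have "(\<Sum>a<D j. ?G a a) = 1"
      using \<psi> vec_norm_slice[OF j, of D \<psi>] of_real_weight[of "{..<D j}" "rest N D j" "slice j \<psi>"] by simp
    moreover have "(\<Sum>a<D j. e a * cnj (e a)) = complex_of_real p"
      unfolding p_def by (simp only: of_real_sum complex_norm_square)
    ultimately show ?thesis
      using p by (simp add: op_trace_def sum_subtractf flip: sum_divide_distrib)
  qed
  ultimately show ?thesis
    unfolding eq by (rule Greatest_hs_inner[OF d])
qed

text \<open>The squared norm of a difference is expanded entrywise. The normalized rank-one operator
  has purity one, so after multiplication by \<open>p\<close> the last term is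
  \<open>p\<close>.\<close>

lemma hs_norm2_diff_rank_one:
  assumes p: "p = (\<Sum>a\<in>X. (cmod (e a))\<^sup>2)" "p \<noteq> 0"
  shows "p * hs_norm2 X (\<lambda>a b. G a b - e a * cnj (e b) / complex_of_real p) =
    p * hs_norm2 X G - 2 * Re (\<Sum>a\<in>X. \<Sum>b\<in>X. cnj (G a b) * (e a * cnj (e b))) + p"
proof -
  have "p * (cmod (G a b - e a * cnj (e b) / complex_of_real p))\<^sup>2 =
      p * (cmod (G a b))\<^sup>2 - 2 * Re (cnj (G a b) * (e a * cnj (e b)))
        + (cmod (e a))\<^sup>2 * (cmod (e b))\<^sup>2 / p" for a b
  proof -
    have polar: "(cmod (z - w / complex_of_real p))\<^sup>2 =
        (cmod z)\<^sup>2 - 2 * Re (cnj z * w) / p + (cmod w)\<^sup>2 / p\<^sup>2" for z w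
      by (simp add: cmod_power2 power2_diff power_divide add_divide_distrib algebra_simps)
    show ?thesis
      unfolding polar using p(2)
      by (simp add: norm_mult power_mult_distrib power2_eq_square field_simps)
  qed
  then have "p * hs_norm2 X (\<lambda>a b. G a b - e a * cnj (e b) / complex_of_real p) =
     (\<Sum>a\<in>X. \<Sum>b\<in>X. p * (cmod (G a b))\<^sup>2 - 2 * Re (cnj (G a b) * (e a * cnj (e b)))
        + (cmod (e a))\<^sup>2 * (cmod (e b))\<^sup>2 / p)"
    by (simp only: hs_norm2_def sum_distrib_left)
  also have "\<dots> = p * hs_norm2 X G - 2 * Re (\<Sum>a\<in>X. \<Sum>b\<in>X. cnj (G a b) * (e a * cnj (e b)))
     + (\<Sum>a\<in>X. \<Sum>b\<in>X. (cmod (e a))\<^sup>2 * (cmod (e b))\<^sup>2) / p"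
    by (simp only: hs_norm2_def sum.distrib sum_subtractf sum_distrib_left sum_divide_distrib Re_sum)
  also have "(\<Sum>a\<in>X. \<Sum>b\<in>X. (cmod (e a))\<^sup>2 * (cmod (e b))\<^sup>2) / p = p"
    using p by (simp flip: sum_product)
  finally show ?thesis .
qed

section \<open>Value of the entanglement and monotonicity\<close>

text \<open>Turns the sum over a set of projectors into a sum over basis vectors. Equal projectors
  give two unit vectors an overlap of modulus one, which excludes orthogonality.\<close>

lemma inj_on_projectors:
  assumes j: "j \<in> {1..N}" and B: "orthonormal_basis (rest N D j) B"
  shows "inj_on (\<lambda>\<chi>. tensor_op N j op_id (ketbra \<chi> \<chi>)) B"
proof (rule inj_onI)
  let ?R = "rest N D j"
  fix \<chi> \<xi> assume in_B: "\<chi> \<in> B" "\<xi> \<in> B"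
    and eq: "tensor_op N j op_id (ketbra \<chi> \<chi>) = tensor_op N j op_id (ketbra \<xi> \<xi>)"
  \<comment> \<open>Using the same index, here \<open>0\<close>, at \<open>j\<close> on both sides
    makes the identity factor equal to one.\<close>
  have kb: "\<chi> r * cnj (\<chi> s) = \<xi> r * cnj (\<xi> s)" if "r \<in> ?R" "s \<in> ?R" for r s
    using fun_cong[OF fun_cong[OF eq, of "r(j := 0)"], of "s(j := 0)"] that
    by (simp add: tensor_op_def op_id_def ketbra_def restrict_configs_id)
  have "vec_inner ?R \<xi> \<chi> * vec_inner ?R \<chi> \<xi> = (\<Sum>r\<in>?R. \<Sum>s\<in>?R. cnj (\<xi> r) * \<xi> s * (\<chi> r * cnj (\<chi> s)))"
    by (simp add: vec_inner_def sum_product mult_ac)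
  also have "\<dots> = (\<Sum>r\<in>?R. \<Sum>s\<in>?R. cnj (\<xi> r) * \<xi> s * (\<xi> r * cnj (\<xi> s)))"
    by (intro sum.cong refl) (simp add: kb)
  also have "\<dots> = vec_inner ?R \<xi> \<xi> * vec_inner ?R \<xi> \<xi>"
    by (simp add: vec_inner_def sum_product mult_ac)
  finally show "\<chi> = \<xi>"
    using B in_B by (auto simp: orthonormal_basis_def split: if_splits)
qed

lemma measured_entanglement_eq:
  assumes j: "j \<in> {1..N}" and d: "2 \<le> D j" and \<psi>: "vec_norm (whole N D) \<psi> = 1"
    and M: "M \<in> projective_measurements N D j"
  shows "measured_entanglement N D j M (ketbra \<psi> \<psi>) = 1 - local_purity N D j \<psi>"
proof -
  let ?R = "rest N D j" and ?X = "{..<D j}"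
  let ?G = "gram ?R (slice j \<psi>)"
  let ?P = "\<lambda>\<chi>. tensor_op N j op_id (ketbra \<chi> \<chi>)"
  let ?e = "partial_inner ?R (slice j \<psi>)"
  let ?p = "\<lambda>\<chi>. \<Sum>a<D j. (cmod (?e \<chi> a))\<^sup>2"
  let ?c = "\<lambda>\<chi>. \<Sum>a<D j. \<Sum>b<D j. cnj (?G a b) * (?e \<chi> a * cnj (?e \<chi> b))"
  obtain B where M_eq: "M = ?P ` B" and B: "orthonormal_basis ?R B"
    using M by (auto simp: projective_measurements_def)
  have trace_G: "(\<Sum>a<D j. ?G a a) = 1"
    using \<psi> vec_norm_slice[OF j, of D \<psi>] of_real_weight[of ?X ?R "slice j \<psi>"] by simp
  \<comment> \<open>The closed form also covers probability zero, since then the conditional vector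
    vanishes.\<close>
  have term_eq: "(if ?p \<chi> = 0 then 0 else ?p \<chi> *
      (GREATEST r. r \<in> disturbance N D (ketbra \<psi> \<psi>) (?P \<chi>) ` observables N D j)) =
    ?p \<chi> * local_purity N D j \<psi> - 2 * Re (?c \<chi>) + ?p \<chi>" if "\<chi> \<in> B" for \<chi>
  proof (cases "?p \<chi> = 0")
    case True
    then have "\<And>a. a < D j \<Longrightarrow> ?e \<chi> a = 0"
      by (simp add: sum_nonneg_eq_0_iff)
    then have "?c \<chi> = 0" by (intro sum.neutral ballI) simp
    with True show ?thesis by simp
  next
    case False
    have "vec_inner ?R \<chi> \<chi> = 1" using B that by (simp add: orthonormal_basis_def)
    from Greatest_disturbance[where D = D, OF j d \<psi> this False]
    have "?p \<chi> * (GREATEST r. r \<in> disturbance N D (ketbra \<psi> \<psi>) (?P \<chi>) ` observables N D j) =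
      ?p \<chi> * hs_norm2 ?X ?G - 2 * Re (?c \<chi>) + ?p \<chi>"
      using hs_norm2_diff_rank_one[OF refl False, of ?G] by simp
    then show ?thesis using False by (simp only: local_purity_def purity_def if_False)
  qed
  have "complex_of_real (\<Sum>\<chi>\<in>B. ?p \<chi>) = (\<Sum>a<D j. \<Sum>\<chi>\<in>B. ?e \<chi> a * cnj (?e \<chi> a))"
    by (subst sum.swap) (simp only: of_real_sum complex_norm_square)
  then have sum_p: "(\<Sum>\<chi>\<in>B. ?p \<chi>) = 1"
    unfolding sum_partial_inner[OF B] trace_G by (simp only: of_real_eq_1_iff)
  \<comment> \<open>Summing the overlaps of the conditional states with the reduced state gives its
    overlap with itself, the purity.\<close>
  have "(\<Sum>\<chi>\<in>B. ?c \<chi>) = (\<Sum>a<D j. \<Sum>\<chi>\<in>B. \<Sum>b<D j. cnj (?G a b) * (?e \<chi> a * cnj (?e \<chi> b)))"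
    by (rule sum.swap)
  also have "\<dots> = (\<Sum>a<D j. \<Sum>b<D j. \<Sum>\<chi>\<in>B. cnj (?G a b) * (?e \<chi> a * cnj (?e \<chi> b)))"
    by (rule sum.cong[OF refl], rule sum.swap)
  also have "\<dots> = complex_of_real (local_purity N D j \<psi>)"
    unfolding local_purity_def purity_def of_real_hs_norm2
    by (simp only: sum_distrib_left[symmetric] sum_partial_inner[OF B] mult.commute)
  finally have sum_c: "(\<Sum>\<chi>\<in>B. Re (?c \<chi>)) = local_purity N D j \<psi>"
    by (simp only: Re_sum[symmetric] Re_complex_of_real)
  have "measured_entanglement N D j M (ketbra \<psi> \<psi>) =
      (\<Sum>\<chi>\<in>B. ?p \<chi> * local_purity N D j \<psi> - 2 * Re (?c \<chi>) + ?p \<chi>)"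
    unfolding measured_entanglement_def M_eq sum.reindex[OF inj_on_projectors[OF j B]] o_def
      expval_projector[OF j]
    by (intro sum.cong refl term_eq)
  also have "\<dots> = (\<Sum>\<chi>\<in>B. ?p \<chi>) * local_purity N D j \<psi> - 2 * (\<Sum>\<chi>\<in>B. Re (?c \<chi>)) + (\<Sum>\<chi>\<in>B. ?p \<chi>)"
    by (simp only: sum.distrib sum_subtractf sum_distrib_right sum_distrib_left)
  finally show ?thesis unfolding sum_p sum_c by simp
qed

text \<open>All measurements give the same value, so each maximum is over a singleton.\<close>

lemma general_entanglement_eq:
  assumes D: "\<And>j. j \<in> {1..N} \<Longrightarrow> D j \<ge> 2" and \<psi>: "vec_norm (whole N D) \<psi> = 1"
  shows "general_entanglement N D (ketbra \<psi> \<psi>) =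
    1 / real N * (\<Sum>j=1..N. inverse (1 - 1 / real (D j)) * (1 - local_purity N D j \<psi>))"
proof -
  have "(GREATEST e. e \<in> (\<lambda>M. measured_entanglement N D j M (ketbra \<psi> \<psi>)) ` projective_measurements N D j) =
     1 - local_purity N D j \<psi>" if j: "j \<in> {1..N}" for j
  proof -
    have "projective_measurements N D j \<noteq> {}"
      using standard_basis[of "rest N D j"] by (auto simp: projective_measurements_def finite_configs)
    then have "(\<lambda>M. measured_entanglement N D j M (ketbra \<psi> \<psi>)) ` projective_measurements N D j =
        {1 - local_purity N D j \<psi>}"
      using measured_entanglement_eq[OF j D[OF j] \<psi>] by auto
    then show ?thesis by (simp add: Greatest_equality)
  qed
  then show ?thesis by (simp add: general_entanglement_def)
qed

theorem theorem3:
  fixes N :: nat and D :: "nat \<Rightarrow> nat" and \<psi> \<phi> :: "(nat \<Rightarrow> nat) \<Rightarrow> complex"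
  assumes "N \<ge> 2"
    and "\<And>j. j \<in> {1..N} \<Longrightarrow> D j \<ge> 2"
    and "\<psi> \<in> hilb (whole N D)" and "vec_norm (whole N D) \<psi> = 1"
    and "\<phi> \<in> hilb (whole N D)" and "vec_norm (whole N D) \<phi> = 1"
    and "locc_transformable N D \<psi> \<phi>"
  shows "general_entanglement N D (ketbra \<phi> \<phi>) \<le> general_entanglement N D (ketbra \<psi> \<psi>)"
proof -
  \<comment> \<open>The comparison holds party by party, with nonnegative factors.\<close>
  have le: "inverse (1 - 1 / real (D j)) * (1 - local_purity N D j \<phi>) \<le>
      inverse (1 - 1 / real (D j)) * (1 - local_purity N D j \<psi>)" if j: "j \<in> {1..N}" for j
  proof (rule mult_left_mono)
    show "1 - local_purity N D j \<phi> \<le> 1 - local_purity N D j \<psi>"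
      using local_purity_locc_transformable[OF assms(7,4) j] by simp
    show "0 \<le> inverse (1 - 1 / real (D j))"
      using assms(2)[OF j] by simp
  qed
  have eq: "general_entanglement N D (ketbra \<xi> \<xi>) =
      1 / real N * (\<Sum>j=1..N. inverse (1 - 1 / real (D j)) * (1 - local_purity N D j \<xi>))"
    if "vec_norm (whole N D) \<xi> = 1" for \<xi>
    using that assms(2) by (intro general_entanglement_eq)
  show ?thesis
    unfolding eq[OF assms(4)] eq[OF assms(6)]
    by (intro mult_left_mono[OF sum_mono] le) auto
qed

end
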